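(* Let $\mathcal{G}$ be a weighted undirected graph on $V=\{1,\dots,N\}$, let $F\subseteq\{1,\dots,N\}$ be a set of frequency indices and $S\subseteq V$ a sampling set of vertices, let $\mathbf{D}$ and $\mathbf{B}$ be the associated vertex-limiting and frequency-limiting operators, and let $\mathbf{D}^c$ be the vertex-limiting operator associated with $S^c=V\setminus S$. Every signal $f\in\mathbb{R}^N$ bandlimited to $F$ (i.e. $\mathbf{B}f=f$) can be reconstructed from its values on the sampling set $S$ only, i.e. from $\mathbf{D}f$, if and only if $$\|\mathbf{B}\mathbf{D}^c\|_2=\|\mathbf{D}^c\mathbf{B}\|_2<1,$$ i.e. the operator $\mathbf{B}\mathbf{D}^c$ does not have any perfectly localized eigenvector (an eigenvector $x\neq 0$ with $\mathbf{B}x=x$ and $\mathbf{D}^cx=x$).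
   Context: $\mathcal{G}$ is a weighted undirected graph with vertex set $V=\{1,\dots,N\}$ and symmetric adjacency matrix $\mathbf{A}=(a_{ij})$, with $a_{ij}>0$ if there is a link between $i$ and $j$ and $a_{ij}=0$ otherwise. The degree matrix is $\mathbf{K}=\mathrm{diag}(d_1,\dots,d_N)$ with $d_i=\sum_{j}a_{ij}$, and the Laplacian is $\mathbf{L}=\mathbf{K}-\mathbf{A}$, a real symmetric positive semidefinite matrix. Fix an eigendecomposition $\mathbf{L}=\mathbf{U}\mathbf{\Lambda}\mathbf{U}^T$ with $\mathbf{U}$ a real orthogonal matrix whose columns are the eigenvectors. A signal on the graph is a vector in $\mathbb{R}^N$; its Graph Fourier Transform is $\hat f=\mathbf{U}^Tf$. For $S\subseteq V$, the vertex-limiting operator $\mathbf{D}$ is the diagonal $N\times N$ matrix with $D_{ii}=1$ if $i\in S$ and $D_{ii}=0$ otherwise; $\mathbf{D}^c$ is defined in the same way with $S$ replaced by $S^c=V\setminus S$. For $F\subseteq\{1,\dots,N\}$, the frequency-limiting operator is $\mathbf{B}=\mathbf{U}\mathbf{\Sigma}\mathbf{U}^T$, where $\mathbf{\Sigma}$ is the diagonal matrix with $\Sigma_{ii}=1$ if $i\in F$ and $\Sigma_{ii}=0$ otherwise. A signal $f$ is bandlimited to $F$ if its Graph Fourier Transform is supported on $F$, equivalently $\mathbf{B}f=f$. $\|\cdot\|_2$ of a matrix is the spectral norm (largest singular value). "Can be reconstructed from its values on $S$" means that a signal bandlimited to $F$ is uniquely determined by its samples: the map $f\mapsto\mathbf{D}f$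 is injective on $\{f\in\mathbb{R}^N:\mathbf{B}f=f\}$. *)

theory Defs
  imports "HOL-Analysis.Analysis"
begin

text \<open>The finite type \<open>'n\<close> plays the role of \<open>{1, \<dots>, N}\<close>, both for vertices and for frequency
  indices; a signal is an element of \<^typ>\<open>real ^ 'n\<close>.\<close>

definition weighted_adjacency :: "real^'n^'n \<Rightarrow> bool" where
  "weighted_adjacency A \<longleftrightarrow> transpose A = A \<and> (\<forall>i j. A $ i $ j \<ge> 0)"

definition diag :: "('n \<Rightarrow> real) \<Rightarrow> real^'n^'n" where
  "diag d = (\<chi> i j. if i = j then d i else 0)"

definition degree_matrix :: "real^'n^'n \<Rightarrow> real^'n^'n" where
  "degree_matrix A = diag (\<lambda>i. \<Sum>j\<in>UNIV. A $ i $ j)"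

definition laplacian :: "real^'n^'n \<Rightarrow> real^'n^'n" where
  "laplacian A = degree_matrix A - A"

definition eigendecomposition :: "real^'n^'n \<Rightarrow> real^'n^'n \<Rightarrow> ('n \<Rightarrow> real) \<Rightarrow> bool" where
  "eigendecomposition M U lam \<longleftrightarrow> orthogonal_matrix U \<and> M = U ** diag lam ** transpose U"

definition vertex_limiting :: "'n set \<Rightarrow> real^'n^'n" where
  "vertex_limiting S = diag (\<lambda>i. if i \<in> S then 1 else 0)"

definition frequency_limiting :: "real^'n^'n \<Rightarrow> 'n set \<Rightarrow> real^'n^'n" where
  "frequency_limiting U F = U ** diag (\<lambda>i. if i \<in> F then 1 else 0) ** transpose U"

definition eigenvector :: "real^'n^'n \<Rightarrow> real \<Rightarrow> real^'n \<Rightarrow> bool" where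
  "eigenvector M c x \<longleftrightarrow> x \<noteq> 0 \<and> M *v x = c *s x"

definition singular_values :: "real^'n^'n \<Rightarrow> real set" where
  "singular_values M = {sqrt c | c. \<exists>x. eigenvector (transpose M ** M) c x}"

text \<open>The maximum exists: \<open>singular_values M\<close> is finite and nonempty, as shown below.\<close>

definition spectral_norm :: "real^'n^'n \<Rightarrow> real" where
  "spectral_norm M = Max (singular_values M)"

lemma inner_gram: "(transpose M ** M *v x) \<bullet> y = (M *v x) \<bullet> (M *v (y::real^'n))"
  for M :: "real^'n^'n"
proof -
  have "(transpose M ** M *v x) \<bullet> y = (transpose M *v (M *v x)) \<bullet> y"
    by (simp add: matrix_vector_mul_assoc)
  also have "\<dots> = (M *v x) \<bullet> (M *v y)"
    by (metis dot_lmul_matrix vector_transpose_matrix transpose_transpose)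
  finally show ?thesis .
qed

lemma finite_singular_values: "finite (singular_values (M::real^'n^'n))"
proof -
  let ?T = "transpose M ** M"
  let ?E = "{c. \<exists>x. eigenvector ?T c x}"
  define v where "v = (\<lambda>c. SOME x. eigenvector ?T c x)"
  have v: "eigenvector ?T c (v c)" if "c \<in> ?E" for c
    using that unfolding v_def by (auto intro: someI_ex)
  have orth: "orthogonal (v c) (v d)" if cd: "c \<in> ?E" "d \<in> ?E" "c \<noteq> d" for c d
  proof -
    have "(?T *v v c) \<bullet> v d = (?T *v v d) \<bullet> v c"
      by (metis inner_gram inner_commute)
    then have "c * (v c \<bullet> v d) = d * (v c \<bullet> v d)"
      using v[OF cd(1)] v[OF cd(2)]
      by (simp add: eigenvector_def scalar_mult_eq_scaleR inner_commute)
    with cd(3) show ?thesis by (simp add: orthogonal_def)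
  qed
  have inj: "inj_on v ?E"
  proof (rule inj_onI)
    fix c d assume "c \<in> ?E" "d \<in> ?E" "v c = v d"
    then show "c = d"
      using orth[of c d] v[of c] by (auto simp: eigenvector_def orthogonal_def)
  qed
  have "pairwise orthogonal (v ` ?E)"
    unfolding pairwise_def using orth by blast
  then have "finite (v ` ?E)" by (rule pairwise_orthogonal_imp_finite)
  then have "finite ?E" using inj by (rule finite_imageD)
  moreover have "singular_values M = sqrt ` ?E" by (auto simp: singular_values_def)
  ultimately show ?thesis by simp
qed

lemma onorm_in_singular_values: "onorm ((*v) M) \<in> singular_values (M::real^'n^'n)"
proof -
  let ?T = "transpose M ** M"
  have "compact (sphere (0::real^'n) 1)" by simp
  moreover have "sphere (0::real^'n) 1 \<noteq> {}" by simp
  moreover have "continuous_on (sphere 0 1) (\<lambda>x. norm (M *v x))"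
    by (intro continuous_on_norm linear_continuous_on matrix_vector_mul_bounded_linear)
  ultimately obtain v where v: "norm v = 1"
    and max: "\<And>y. norm y = 1 \<Longrightarrow> norm (M *v y) \<le> norm (M *v v)"
    using continuous_attains_sup[of "sphere (0::real^'n) 1" "\<lambda>x. norm (M *v x)"]
    by (metis mem_sphere_0)
  define s where "s = norm (M *v v)"
  have le: "norm (M *v y) \<le> s * norm y" for y
  proof (cases "y = 0")
    case False
    then have "norm (M *v ((1 / norm y) *\<^sub>R y)) \<le> s"
      unfolding s_def by (intro max) simp
    then have "norm (M *v y) / norm y \<le> s"
      by (simp add: matrix_vector_mult_scaleR)
    with False show ?thesis by (simp add: divide_simps)
  qed simp
  have s: "onorm ((*v) M) = s"
  proof (rule antisym)
    show "onorm ((*v) M) \<le> s" by (rule onorm_le) (rule le)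
    show "s \<le> onorm ((*v) M)"
      using onorm[OF matrix_vector_mul_bounded_linear, of M v] v by (simp add: s_def)
  qed
  have s0: "s \<ge> 0" by (simp add: s_def)
  define w where "w = s\<^sup>2 *\<^sub>R v - ?T *v v"
  define q where "q = (\<lambda>y. s\<^sup>2 * (y \<bullet> y) - (M *v y) \<bullet> (M *v y))"
  have q0: "q y \<ge> 0" for y
    using power_mono[OF le[of y], of 2]
    by (simp add: q_def power_mult_distrib dot_square_norm)
  have qv: "q v = 0" using v by (simp add: q_def dot_square_norm s_def)
  have ww: "w \<bullet> w = s\<^sup>2 * (v \<bullet> w) - (M *v v) \<bullet> (M *v w)"
    by (subst (1) w_def) (simp add: inner_diff_left inner_gram)
  have exp: "q (v + t *\<^sub>R w) = q v + 2 * t * (w \<bullet> w) + t\<^sup>2 * q w" for t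
    unfolding ww
    by (simp add: q_def matrix_vector_right_distrib matrix_vector_mult_scaleR inner_add_left
        inner_add_right inner_commute power2_eq_square algebra_simps)
  have "w \<bullet> w = 0"
  proof (rule ccontr)
    assume "w \<bullet> w \<noteq> 0"
    then have p: "w \<bullet> w > 0" by (simp add: inner_gt_zero_iff)
    define t where "t = - (w \<bullet> w) / (1 + q w)"
    have d: "1 + q w > 0" using q0[of w] by simp
    have "q (v + t *\<^sub>R w) = t * (2 * (w \<bullet> w) + t * q w)"
      by (simp add: exp qv power2_eq_square algebra_simps)
    moreover have "t < 0" using p d by (simp add: t_def)
    moreover have "2 * (w \<bullet> w) + t * q w > 0"
    proof -
      have "(w \<bullet> w) * q w \<le> (w \<bullet> w) * (1 + q w)" using p by simp
      then have "(w \<bullet> w) * q w / (1 + q w) \<le> w \<bullet> w" using d by (simp add: divide_simps)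
      then have "t * q w \<ge> - (w \<bullet> w)" by (simp add: t_def)
      with p show ?thesis by linarith
    qed
    ultimately have "q (v + t *\<^sub>R w) < 0" by (simp add: mult_neg_pos)
    with q0[of "v + t *\<^sub>R w"] show False by simp
  qed
  then have "?T *v v = s\<^sup>2 *s v" by (simp add: w_def scalar_mult_eq_scaleR)
  moreover have "v \<noteq> 0" using v by auto
  ultimately have "eigenvector ?T (s\<^sup>2) v" by (simp add: eigenvector_def)
  moreover have "s = sqrt (s\<^sup>2)" using s0 by simp
  ultimately show ?thesis unfolding s singular_values_def by blast
qed

lemma spectral_norm_eq_onorm: "spectral_norm (M::real^'n^'n) = onorm ((*v) M)"
  unfolding spectral_norm_def
proof (rule Max_eqI[OF finite_singular_values _ onorm_in_singular_values])
  fix y assume "y \<in> singular_values M"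
  then obtain c x where y: "y = sqrt c" and x: "eigenvector (transpose M ** M) c x"
    by (auto simp: singular_values_def)
  have nx: "norm x > 0" using x by (simp add: eigenvector_def)
  have "c * (norm x)\<^sup>2 = (norm (M *v x))\<^sup>2"
    using x inner_gram[of M x x]
    by (simp add: eigenvector_def scalar_mult_eq_scaleR dot_square_norm)
  then have "sqrt c * norm x = norm (M *v x)"
    by (metis real_sqrt_mult real_sqrt_abs abs_norm_cancel)
  also have "\<dots> \<le> onorm ((*v) M) * norm x"
    by (rule onorm[OF matrix_vector_mul_bounded_linear])
  finally show "y \<le> onorm ((*v) M)" using nx y by simp
qed

end

theory Submission
  imports Defs
begin

text \<open>\<open>B\<close> and \<open>Dc\<close> are orthogonal projections. An orthogonal projection shrinks the norm of every
  vector that it does not fix, and the operator norm of \<open>Dc ** B\<close> is attained, so it is \<open>1\<close> or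
  more exactly when some nonzero vector is fixed by both projections. Since \<open>D = 1 - Dc\<close>, such a
  vector is the same as a nonzero bandlimited signal whose samples vanish, i.e. an obstruction to
  injectivity.\<close>

definition orthogonal_projection :: "real^'n^'n \<Rightarrow> bool" where
  "orthogonal_projection P \<longleftrightarrow> transpose P = P \<and> P ** P = P"

lemma transpose_diag: "transpose (diag d) = diag d"
  by (auto simp: diag_def transpose_def vec_eq_iff)

lemma diag_mult_vector: "diag d *v x = (\<chi> i. d i * x $ i)"
  by (simp add: diag_def matrix_vector_mult_def vec_eq_iff if_distrib [of "\<lambda>u. u * _"] cong: if_cong)

lemma orthogonal_projection_diag_indicator:
  "orthogonal_projection (diag (\<lambda>i. if i \<in> S then 1 else 0))"
  unfolding orthogonal_projection_def transpose_diag
  by (simp add: matrix_eq matrix_vector_mul_assoc [symmetric] diag_mult_vector vec_eq_iff)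

lemma orthogonal_projection_vertex_limiting: "orthogonal_projection (vertex_limiting S)"
  unfolding vertex_limiting_def by (rule orthogonal_projection_diag_indicator)

text \<open>Reassociating the square brings the inner factors together as
  \<open>transpose U ** U\<close>, which orthogonality turns into the identity.\<close>

lemma orthogonal_projection_conjugate:
  assumes "orthogonal_matrix U" "orthogonal_projection P"
  shows "orthogonal_projection (U ** P ** transpose U)"
proof -
  have "U ** P ** transpose U ** (U ** P ** transpose U)
      = U ** (P ** (transpose U ** U) ** P) ** transpose U"
    by (simp add: matrix_mul_assoc)
  with assms show ?thesis
    by (simp add: orthogonal_projection_def orthogonal_matrix_def matrix_transpose_mul
        matrix_mul_assoc)
qed

lemma orthogonal_projection_frequency_limiting:
  "orthogonal_matrix U \<Longrightarrow> orthogonal_projection (frequency_limiting U F)"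
  unfolding frequency_limiting_def
  by (intro orthogonal_projection_conjugate orthogonal_projection_diag_indicator)

text \<open>Pythagoras: symmetry and idempotence give
  \<open>(P *v x) \<bullet> x = (P *v x) \<bullet> (P *v x)\<close>, so \<open>P *v x\<close> is
  orthogonal to the residual \<open>x - P *v x\<close>.\<close>

lemma norm_orthogonal_projection:
  assumes "orthogonal_projection P"
  shows "(norm x)\<^sup>2 = (norm (P *v x))\<^sup>2 + (norm (x - P *v x))\<^sup>2"
proof -
  have "(P *v x) \<bullet> x = (P *v x) \<bullet> (P *v x)"
    using inner_gram [of P x x] assms by (simp add: orthogonal_projection_def)
  then show ?thesis
    by (simp add: power2_norm_eq_inner inner_diff_left inner_diff_right inner_commute)
qed

lemma norm_orthogonal_projection_le:
  assumes "orthogonal_projection P"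
  shows "norm (P *v x) \<le> norm x"
  using norm_orthogonal_projection [OF assms, of x] by (simp add: power2_le_imp_le)

text \<open>The equality case of the contraction bound: Pythagoras leaves no room for a nonzero
  residual.\<close>

lemma orthogonal_projection_fixed_if_norm_ge:
  assumes "orthogonal_projection P" "norm x \<le> norm (P *v x)"
  shows "P *v x = x"
proof -
  have "(norm x)\<^sup>2 \<le> (norm (P *v x))\<^sup>2"
    using assms(2) by (simp add: power_mono)
  with norm_orthogonal_projection [OF assms(1), of x] have "(norm (x - P *v x))\<^sup>2 \<le> 0"
    by linarith
  then show ?thesis by simp
qed

text \<open>Moving one factor of the squared norm of \<open>transpose M *v x\<close> across the
  inner product, Cauchy-Schwarz and the operator bound for \<open>M\<close> give the estimate times
  an extra \<open>norm ?y\<close>, which is then cancelled. Equality follows since transposition is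
  an involution.\<close>

lemma spectral_norm_transpose_le: "spectral_norm (transpose M) \<le> spectral_norm M"
  unfolding spectral_norm_eq_onorm
proof (rule onorm_le)
  fix x
  let ?y = "transpose M *v x"
  have "norm ?y * norm ?y = x \<bullet> (M *v ?y)"
    by (metis dot_lmul_matrix norm_eq_square power2_eq_square power2_norm_eq_inner
        vector_transpose_matrix transpose_transpose)
  also have "\<dots> \<le> norm x * norm (M *v ?y)"
    by (rule norm_cauchy_schwarz)
  also have "\<dots> \<le> norm x * (onorm ((*v) M) * norm ?y)"
    by (intro mult_left_mono onorm matrix_vector_mul_bounded_linear norm_ge_zero)
  finally have *: "norm ?y * norm ?y \<le> (onorm ((*v) M) * norm x) * norm ?y"
    by (simp add: mult_ac)
  show "norm ?y \<le> onorm ((*v) M) * norm x"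
  proof (cases "?y = 0")
    case True
    then show ?thesis by (simp add: onorm_pos_le)
  next
    case False
    with * show ?thesis by simp
  qed
qed

lemma spectral_norm_transpose: "spectral_norm (transpose M) = spectral_norm M"
  using spectral_norm_transpose_le [of M] spectral_norm_transpose_le [of "transpose M"] by simp

text \<open>The maximal singular value belongs to an eigenvector of the Gram matrix
  \<open>transpose M ** M\<close>, and pairing the eigenvector equation with that vector shows that
  it is a maximizer.\<close>

lemma spectral_norm_attained:
  obtains x where "x \<noteq> 0" "norm (M *v x) = spectral_norm M * norm x"
proof -
  obtain c x where c: "spectral_norm M = sqrt c" and x: "eigenvector (transpose M ** M) c x"
    using onorm_in_singular_values [of M]
    by (auto simp: singular_values_def spectral_norm_eq_onorm)
  have "c * (norm x)\<^sup>2 = (norm (M *v x))\<^sup>2"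
    using x inner_gram [of M x x]
    by (simp add: eigenvector_def scalar_mult_eq_scaleR dot_square_norm)
  then have "norm (M *v x) = sqrt c * norm x"
    by (metis real_sqrt_mult real_sqrt_abs abs_norm_cancel)
  then show ?thesis
    using that [of x] c x by (simp add: eigenvector_def)
qed

lemma spectral_norm_projections_less_one_iff:
  assumes P: "orthogonal_projection P" and Q: "orthogonal_projection Q"
  shows "spectral_norm (Q ** P) < 1 \<longleftrightarrow> \<not> (\<exists>x. x \<noteq> 0 \<and> P *v x = x \<and> Q *v x = x)"
proof (rule iffI; rule ccontr)
  assume less: "spectral_norm (Q ** P) < 1"
    and "\<not> \<not> (\<exists>x. x \<noteq> 0 \<and> P *v x = x \<and> Q *v x = x)"
  then obtain x where x: "x \<noteq> 0" "P *v x = x" "Q *v x = x" by blast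
  \<comment> \<open>A common fixed vector is fixed by \<open>Q ** P\<close>, so no norm below 1 can
    bound it.\<close>
  have "norm x \<le> spectral_norm (Q ** P) * norm x"
    using onorm [OF matrix_vector_mul_bounded_linear, of "Q ** P" x] x
    by (simp add: spectral_norm_eq_onorm matrix_vector_mul_assoc [symmetric])
  with less x show False by simp
next
  assume none: "\<not> (\<exists>x. x \<noteq> 0 \<and> P *v x = x \<and> Q *v x = x)"
    and ge: "\<not> spectral_norm (Q ** P) < 1"
  obtain x where x: "x \<noteq> 0" "norm (Q ** P *v x) = spectral_norm (Q ** P) * norm x"
    by (rule spectral_norm_attained)
  \<comment> \<open>For the maximizer \<open>x\<close>, the norms of \<open>x\<close>,
    \<open>P *v x\<close> and \<open>Q *v (P *v x)\<close> are squeezed together, so each projection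
    in turn fixes its argument.\<close>
  have ge': "norm x \<le> norm (Q *v (P *v x))"
    using x(2) ge mult_right_mono [of 1 "spectral_norm (Q ** P)" "norm x"]
    by (simp add: matrix_vector_mul_assoc)
  also have "\<dots> \<le> norm (P *v x)"
    by (rule norm_orthogonal_projection_le [OF Q])
  finally have "P *v x = x"
    by (rule orthogonal_projection_fixed_if_norm_ge [OF P])
  moreover from this ge' have "Q *v x = x"
    by (intro orthogonal_projection_fixed_if_norm_ge [OF Q]) simp
  ultimately show False using none x(1) by blast
qed

text \<open>Both sides say that \<open>x\<close> vanishes on \<open>S\<close>.\<close>

lemma vertex_limiting_eq_zero_iff:
  "vertex_limiting S *v x = 0 \<longleftrightarrow> vertex_limiting (UNIV - S) *v x = x"
  by (auto simp: vertex_limiting_def diag_mult_vector vec_eq_iff)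

lemma inj_on_fixed_vectors_iff:
  fixes B D :: "real^'n^'n"
  shows "inj_on (\<lambda>f. D *v f) {f. B *v f = f} \<longleftrightarrow> \<not> (\<exists>x. x \<noteq> 0 \<and> B *v x = x \<and> D *v x = 0)"
proof
  assume inj: "inj_on (\<lambda>f. D *v f) {f. B *v f = f}"
  show "\<not> (\<exists>x. x \<noteq> 0 \<and> B *v x = x \<and> D *v x = 0)"
    \<comment> \<open>The zero signal is itself bandlimited and has zero samples.\<close>
    using inj_onD [OF inj, of _ 0] by auto
next
  assume none: "\<not> (\<exists>x. x \<noteq> 0 \<and> B *v x = x \<and> D *v x = 0)"
  show "inj_on (\<lambda>f. D *v f) {f. B *v f = f}"
  proof (rule inj_onI)
    fix f g
    assume "f \<in> {f. B *v f = f}" "g \<in> {f. B *v f = f}" "D *v f = D *v g"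
    then have "B *v (f - g) = f - g" "D *v (f - g) = 0"
      by (simp_all add: matrix_vector_mult_diff_distrib)
    with none have "f - g = 0" by blast
    then show "f = g" by simp
  qed
qed

theorem theorem3p1:
  fixes A U B D Dc :: "real^'n^'n" and lam :: "'n \<Rightarrow> real" and F S :: "'n set"
  assumes "weighted_adjacency A"
    and "eigendecomposition (laplacian A) U lam"
    and "D = vertex_limiting S"
    and "Dc = vertex_limiting (UNIV - S)"
    and "B = frequency_limiting U F"
  shows "spectral_norm (B ** Dc) = spectral_norm (Dc ** B)
    \<and> (inj_on (\<lambda>f. D *v f) {f. B *v f = f} \<longleftrightarrow> spectral_norm (Dc ** B) < 1)
    \<and> (spectral_norm (Dc ** B) < 1
         \<longleftrightarrow> \<not> (\<exists>x c. eigenvector (B ** Dc) c x \<and> B *v x = x \<and> Dc *v x = x))"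
proof -
  have B: "orthogonal_projection B"
    using assms(2,5) by (simp add: eigendecomposition_def orthogonal_projection_frequency_limiting)
  have Dc: "orthogonal_projection Dc"
    using assms(4) by (simp add: orthogonal_projection_vertex_limiting)
  note less = spectral_norm_projections_less_one_iff [OF B Dc]
  have "transpose (Dc ** B) = B ** Dc"
    using B Dc by (simp add: matrix_transpose_mul orthogonal_projection_def)
  then have "spectral_norm (B ** Dc) = spectral_norm (Dc ** B)"
    by (metis spectral_norm_transpose)
  moreover have "inj_on (\<lambda>f. D *v f) {f. B *v f = f} \<longleftrightarrow> spectral_norm (Dc ** B) < 1"
    unfolding less inj_on_fixed_vectors_iff by (simp add: assms(3,4) vertex_limiting_eq_zero_iff)
  \<comment> \<open>Every nonzero common fixed vector is an eigenvector for eigenvalue 1, which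
    supplies the witness for \<open>c\<close>.\<close>
  moreover have "eigenvector (B ** Dc) 1 x" if "x \<noteq> 0" "B *v x = x" "Dc *v x = x" for x
    using that by (simp add: eigenvector_def matrix_vector_mul_assoc [symmetric])
  then have "spectral_norm (Dc ** B) < 1
      \<longleftrightarrow> \<not> (\<exists>x c. eigenvector (B ** Dc) c x \<and> B *v x = x \<and> Dc *v x = x)"
    unfolding less by (metis eigenvector_def)
  ultimately show ?thesis by blast
qed

end
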